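(* Let $M>0$, $H\in\mathbb{R}$, $c_1>-8M^3H$, $\bar c_1\in\mathbb{R}$. Take $r_1>2M$ with $r_1+2M\ln|r_1-2M|=0$ as the base point in the definition of $f_1$, and denote $\tilde f'(r)=f_1'(r)-\frac1{h(r)}$, which can be expressed as $$\tilde f'(r)=\frac{-r^4}{(Hr^3+c_1)^2+r^3(r-2M)+(Hr^3+c_1)\sqrt{(Hr^3+c_1)^2+r^3(r-2M)}}$$ (this expression is also used to define $\tilde f'$ for $r\le 2M$). Suppose that $\Sigma^1_{H,c_1,\bar c_1}$ in region I connects smoothly with $\Sigma^4_{H,c_1,\bar c_4'}$ in region II$'$. Then $$\bar c_4'=\bar c_1+\int_{r_4'}^{r_1}\tilde f'(r)\,\mathrm{d}r+(r_4'+2M\ln|r_4'-2M|),$$ where $r_4'<2M$ is the base point of $f_4^{**}$, lying in its domain. Suppose moreover that $-8M^3H<c_1<C_H$, where $C_H=\max_{r\in(0,2M)}\left(-Hr^3+r^{3/2}(2M-r)^{1/2}\right)$, so that $f_4^*$ and $f_4^{**}$ are defined on an interval $[r'',2M)$, and that $\Sigma^4_{H,c_1,\bar c_4'}$ connects smoothly with $\Sigma^3_{H,c_1,\bar c_3}$ in region I$'$. If one takes $r_4'=r_4=r''$, $\bar c_4'=\bar c_4$ and $r_3=r_1$, then $$\bar c_3=\bar c_4'+\int_{r''}^{r_3}\tilde f'(r)\,\mathrm{d}r+(r''+2M\ln|r''-2M|)=\bar c_1+2\int_{r''}^{r_1}\tilde f'(r)\,\mathrm{d}r+2(r''+2M\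ln|r''-2M|).$$
   Context: Kruskal extension: for $M>0$ and $h(r)=1-\frac{2M}{r}$, it is the manifold $\{(U,V)\in\mathbb{R}^2: UV>-2M\}\times\mathbb{S}^2$ with metric $\mathrm{d}s^2=\frac{16M^2e^{-r/2M}}{r}\,\mathrm{d}U\,\mathrm{d}V+r^2(\mathrm{d}\theta^2+\sin^2\theta\,\mathrm{d}\phi^2)$, where $r>0$ is determined by $(r-2M)e^{r/2M}=UV$. With $X=\frac{V+U}2$, $T=\frac{V-U}2$, $\partial_T$ is taken to be future directed. Regions: I $=\{U>0,V>0\}$, II $=\{U<0,V>0\}$, I$'=\{U<0,V<0\}$, II$'=\{U>0,V<0\}$. In each region one uses coordinates $(t,r,\theta,\phi)$ with $t=2M\ln|V/U|$; equivalently, with $u=t-(r+2M\ln|r-2M|)$, $v=t+(r+2M\ln|r-2M|)$, one has $|U|=e^{-u/4M}$, $|V|=e^{v/4M}$. In these coordinates $\mathrm{d}s^2=-h\,\mathrm{d}t^2+h^{-1}\mathrm{d}r^2+r^2(\mathrm{d}\theta^2+\sin^2\theta\,\mathrm{d}\phi^2)$; regions I, I$'$ correspond to $r>2M$ and II, II$'$ to $0<r<2M$. $\Sigma^1_{H,c,\bar c_1}$ is the hypersurface $t=f_1(r)$, $r>2M$, in region I with $f_1(r)=\int_{r_1}^r\frac{l_1(x)}{h(x)}\frac{\mathrm{d}x}{\sqrt{1+l_1(x)^2}}+\bar c_1$, $l_1(r)=\frac1{\sqrt{h(r)}}\left(Hr+\frac{c}{r^2}\right)$. $\Sigma^3_{H,c,\bar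 c_3}$ is the hypersurface $t=f_3(r)$, $r>2M$, in region I$'$ with $f_3(r)=\int_{r_3}^r\frac{l_3(x)}{h(x)}\frac{\mathrm{d}x}{\sqrt{1+l_3(x)^2}}+\bar c_3$, $l_3=-l_1$. In region II$'$, let $l_4(r)=\frac1{\sqrt{-h(r)}}\left(Hr+\frac{c}{r^2}\right)$ and $f_4^*(r)=\int_{r_4}^r\frac1{-h(x)}\sqrt{\frac{l_4(x)^2}{l_4(x)^2-1}}\,\mathrm{d}x+\bar c_4$, $f_4^{**}(r)=\int_{r_4'}^r\frac1{h(x)}\sqrt{\frac{l_4(x)^2}{l_4(x)^2-1}}\,\mathrm{d}x+\bar c_4'$, defined where $l_4>1$, equivalently $\tilde k_H(r):=-Hr^3+r^{3/2}(2M-r)^{1/2}<c$, and also at points with $\tilde k_H(r)=c$ at which the integral is finite. Let $R_H$ be the unique maximum point of $\tilde k_H$ on $(0,2M)$ and $C_H=\tilde k_H(R_H)>-8M^3H$. For $c>C_H$ the domain is $(0,2M)$; for $c=C_H$ the relevant component of the domain is $(R_H,2M)$; in these cases $\Sigma^4_{H,c,\bar c_4'}$ is the hypersurface $t=f_4^{**}(r)$ in region II$'$ over that interval. For $-8M^3H<c<C_H$ the relevant component of the domain is $[r'',2M)$ with $\tilde k_H(r'')=c$, and $\Sigma^4_{H,c,\bar c_4'}$ is the union of the hypersurfaces $t=f_4^*(r)$ and $t=f_4^{**}(r)$ over $[r'',2M)$ (matching at $r''$). These are spacelike spherically symmetric hypersurfaces of constant mean curvature $H$. Two such hypersurfaces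 in adjacent regions connect smoothly if their union, together with the limiting 2-sphere on the common boundary $r=2M$ of the two regions, is a smooth spacelike hypersurface in the Kruskal extension (regions I and II$'$ meet along $\{V=0,U>0\}$; II$'$ and I$'$ along $\{U=0,V<0\}$).
   Formalization: The integrals of f̃' enter the formulas for c̄4' and c̄3 with a minus sign instead of the printed plus: continuity of U (resp. V) across r=2M forces the minus, and since f̃'<0 the printed formulas fail for every smoothly connecting pair. *)

theory Defs
  imports "HOL-Analysis.Analysis"
begin

section \<open>Smooth functions and the Kruskal extension\<close>

text \<open>The next two notions are meant for open sets only.\<close>

primrec Ck_on :: "nat \<Rightarrow> 'a::real_normed_vector set \<Rightarrow> ('a \<Rightarrow> real) \<Rightarrow> bool" where
  "Ck_on 0 W f \<longleftrightarrow> continuous_on W f"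
| "Ck_on (Suc k) W f \<longleftrightarrow>
     (\<forall>x\<in>W. f differentiable (at x)) \<and> (\<forall>v. Ck_on k W (\<lambda>x. frechet_derivative f (at x) v))"

definition smooth_on :: "'a::real_normed_vector set \<Rightarrow> ('a \<Rightarrow> real) \<Rightarrow> bool" where
  "smooth_on W f \<longleftrightarrow> (\<forall>k. Ck_on k W f)"

text \<open>A point is a triple of the null coordinates U, V and a point of the unit sphere in
  three-dimensional Euclidean space. Tangent vectors are triples of the same type.\<close>

type_synonym kpoint = "real \<times> real \<times> (real ^ 3)"

definition kruskal :: "real \<Rightarrow> kpoint set" where
  "kruskal M = {(U, V, w). U * V > - 2 * M \<and> w \<in> sphere 0 1}"

definition area_radius :: "real \<Rightarrow> kpoint \<Rightarrow> real" where
  "area_radius M = (\<lambda>(U, V, w). THE r. r > 0 \<and> (r - 2 * M) * exp (r / (2 * M)) = U * V)"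

definition schw_time :: "real \<Rightarrow> kpoint \<Rightarrow> real" where
  "schw_time M = (\<lambda>(U, V, w). 2 * M * ln \<bar>V / U\<bar>)"

definition tangent_space :: "kpoint \<Rightarrow> kpoint set" where
  "tangent_space = (\<lambda>(U, V, w). {(a, b, \<xi>). w \<bullet> \<xi> = 0})"

text \<open>The quadratic form of the metric. The round metric of the unit sphere is the restriction
  of the Euclidean inner product.\<close>

definition kruskal_metric :: "real \<Rightarrow> kpoint \<Rightarrow> kpoint \<Rightarrow> real" where
  "kruskal_metric M p = (\<lambda>(a, b, \<xi>). let r = area_radius M p in
     16 * M^2 * exp (- r / (2 * M)) / r * (a * b) + r^2 * (\<xi> \<bullet> \<xi>))"

section \<open>Smooth spacelike hypersurfaces\<close>

definition local_equation :: "real \<Rightarrow> kpoint set \<Rightarrow> kpoint set \<Rightarrow> (kpoint \<Rightarrow> real) \<Rightarrow> bool" where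
  "local_equation M S W F \<longleftrightarrow>
     open W \<and> smooth_on W F \<and> S \<inter> W = {q \<in> kruskal M \<inter> W. F q = 0} \<and>
     (\<forall>q\<in>S \<inter> W. \<exists>X\<in>tangent_space q. frechet_derivative F (at q) X \<noteq> 0)"

definition smooth_hypersurface :: "real \<Rightarrow> kpoint set \<Rightarrow> bool" where
  "smooth_hypersurface M S \<longleftrightarrow>
     S \<subseteq> kruskal M \<and> (\<forall>p\<in>S. \<exists>W F. p \<in> W \<and> local_equation M S W F)"

definition spacelike :: "real \<Rightarrow> kpoint set \<Rightarrow> bool" where
  "spacelike M S \<longleftrightarrow>
     (\<forall>p\<in>S. \<forall>W F. p \<in> W \<longrightarrow> local_equation M S W F \<longrightarrow>
        (\<forall>X\<in>tangent_space p. X \<noteq> 0 \<longrightarrow> frechet_derivative F (at p) X = 0 \<longrightarrow>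
           kruskal_metric M p X > 0))"

section \<open>Regions, horizons and smooth connection\<close>

definition region_I :: "real \<Rightarrow> kpoint set" where
  "region_I M = {(U, V, w) \<in> kruskal M. U > 0 \<and> V > 0}"

definition region_I' :: "real \<Rightarrow> kpoint set" where
  "region_I' M = {(U, V, w) \<in> kruskal M. U < 0 \<and> V < 0}"

definition region_II' :: "real \<Rightarrow> kpoint set" where
  "region_II' M = {(U, V, w) \<in> kruskal M. U > 0 \<and> V < 0}"

definition horizon_I_II' :: "real \<Rightarrow> kpoint set" where
  "horizon_I_II' M = {(U, V, w) \<in> kruskal M. V = 0 \<and> U > 0}"

definition horizon_II'_I' :: "real \<Rightarrow> kpoint set" where
  "horizon_II'_I' M = {(U, V, w) \<in> kruskal M. U = 0 \<and> V < 0}"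

text \<open>The set B is the common boundary of the two regions that contain S and S'.\<close>

definition connect_smoothly :: "real \<Rightarrow> kpoint set \<Rightarrow> kpoint set \<Rightarrow> kpoint set \<Rightarrow> bool" where
  "connect_smoothly M B S S' \<longleftrightarrow>
     (\<exists>a b. closure (S \<union> S') \<inter> B = {a} \<times> {b} \<times> sphere 0 1 \<and>
        smooth_hypersurface M (S \<union> S' \<union> {a} \<times> {b} \<times> sphere 0 1) \<and>
        spacelike M (S \<union> S' \<union> {a} \<times> {b} \<times> sphere 0 1))"

definition time_graph :: "real \<Rightarrow> kpoint set \<Rightarrow> real set \<Rightarrow> (real \<Rightarrow> real) \<Rightarrow> kpoint set" where
  "time_graph M R D f =
     {p \<in> R. area_radius M p \<in> D \<and> schw_time M p = f (area_radius M p)}"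

section \<open>The constant mean curvature hypersurfaces\<close>

definition h :: "real \<Rightarrow> real \<Rightarrow> real" where
  "h M r = 1 - 2 * M / r"

definition rstar :: "real \<Rightarrow> real \<Rightarrow> real" where
  "rstar M r = r + 2 * M * ln \<bar>r - 2 * M\<bar>"

definition l1 :: "real \<Rightarrow> real \<Rightarrow> real \<Rightarrow> real \<Rightarrow> real" where
  "l1 M H c r = 1 / sqrt (h M r) * (H * r + c / r^2)"

definition l3 :: "real \<Rightarrow> real \<Rightarrow> real \<Rightarrow> real \<Rightarrow> real" where
  "l3 M H c r = - l1 M H c r"

definition l4 :: "real \<Rightarrow> real \<Rightarrow> real \<Rightarrow> real \<Rightarrow> real" where
  "l4 M H c r = 1 / sqrt (- h M r) * (H * r + c / r^2)"

text \<open>In the functions below the two arguments before the last are the base point of the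
  integral and the additive constant. The integrals are oriented; an endpoint at which the
  integrand blows up is allowed.\<close>

definition f1 :: "real \<Rightarrow> real \<Rightarrow> real \<Rightarrow> real \<Rightarrow> real \<Rightarrow> real \<Rightarrow> real" where
  "f1 M H c r1 d1 r =
     (LBINT x=ereal r1..ereal r. l1 M H c x / h M x * (1 / sqrt (1 + (l1 M H c x)^2))) + d1"

definition f3 :: "real \<Rightarrow> real \<Rightarrow> real \<Rightarrow> real \<Rightarrow> real \<Rightarrow> real \<Rightarrow> real" where
  "f3 M H c r3 d3 r =
     (LBINT x=ereal r3..ereal r. l3 M H c x / h M x * (1 / sqrt (1 + (l3 M H c x)^2))) + d3"

definition f4s :: "real \<Rightarrow> real \<Rightarrow> real \<Rightarrow> real \<Rightarrow> real \<Rightarrow> real \<Rightarrow> real" where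
  "f4s M H c r4 d4 r =
     (LBINT x=ereal r4..ereal r. 1 / (- h M x) * sqrt ((l4 M H c x)^2 / ((l4 M H c x)^2 - 1))) + d4"

definition f4ss :: "real \<Rightarrow> real \<Rightarrow> real \<Rightarrow> real \<Rightarrow> real \<Rightarrow> real \<Rightarrow> real" where
  "f4ss M H c r4' d4' r =
     (LBINT x=ereal r4'..ereal r. 1 / h M x * sqrt ((l4 M H c x)^2 / ((l4 M H c x)^2 - 1))) + d4'"

definition kH :: "real \<Rightarrow> real \<Rightarrow> real \<Rightarrow> real" where
  "kH M H r = - H * r^3 + r powr (3/2) * (2 * M - r) powr (1/2)"

definition RH :: "real \<Rightarrow> real \<Rightarrow> real" where
  "RH M H = (THE r. r \<in> {0<..<2*M} \<and> (\<forall>s\<in>{0<..<2*M}. kH M H s \<le> kH M H r))"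

definition CH :: "real \<Rightarrow> real \<Rightarrow> real" where
  "CH M H = kH M H (RH M H)"

text \<open>For c between the value of kH at 2 M and its maximum, this is the left endpoint of the
  component, adjacent to 2 M, of the set of all r in (0, 2 M) with kH at most c.\<close>

definition rturn :: "real \<Rightarrow> real \<Rightarrow> real \<Rightarrow> real" where
  "rturn M H c = (THE r. r \<in> {0<..<2*M} \<and> kH M H r = c \<and> (\<forall>s\<in>{r<..<2*M}. kH M H s < c))"

definition dom4 :: "real \<Rightarrow> real \<Rightarrow> real \<Rightarrow> real set" where
  "dom4 M H c =
     (if c > CH M H then {0<..<2*M}
      else if c = CH M H then {RH M H<..<2*M}
      else {rturn M H c..<2*M})"

definition Sigma1 :: "real \<Rightarrow> real \<Rightarrow> real \<Rightarrow> real \<Rightarrow> real \<Rightarrow> kpoint set" where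
  "Sigma1 M H c r1 d1 = time_graph M (region_I M) {2*M<..} (f1 M H c r1 d1)"

definition Sigma3 :: "real \<Rightarrow> real \<Rightarrow> real \<Rightarrow> real \<Rightarrow> real \<Rightarrow> kpoint set" where
  "Sigma3 M H c r3 d3 = time_graph M (region_I' M) {2*M<..} (f3 M H c r3 d3)"

text \<open>The arguments r4 and d4 are relevant only for c below the maximum of kH; in that case the
  two branches have to match at the turning point, see the next definition.\<close>

definition Sigma4 ::
  "real \<Rightarrow> real \<Rightarrow> real \<Rightarrow> real \<Rightarrow> real \<Rightarrow> real \<Rightarrow> real \<Rightarrow> kpoint set" where
  "Sigma4 M H c r4 d4 r4' d4' =
     (if c < CH M H
      then time_graph M (region_II' M) (dom4 M H c) (f4s M H c r4 d4) \<union>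
           time_graph M (region_II' M) (dom4 M H c) (f4ss M H c r4' d4')
      else time_graph M (region_II' M) (dom4 M H c) (f4ss M H c r4' d4'))"

definition branches_match ::
  "real \<Rightarrow> real \<Rightarrow> real \<Rightarrow> real \<Rightarrow> real \<Rightarrow> real \<Rightarrow> real \<Rightarrow> bool" where
  "branches_match M H c r4 d4 r4' d4' \<longleftrightarrow>
     f4s M H c r4 d4 (rturn M H c) = f4ss M H c r4' d4' (rturn M H c)"

text \<open>In regions I and II', ftilde is the r-derivative of the retarded coordinate
  u = t - rstar along the graphs of f1 and f4ss; in regions II' and I', minus ftilde is the
  r-derivative of the advanced coordinate v = t + rstar along the graphs of f4s and f3. With
  rstar vanishing at the base point r1, continuity of u at the horizon between I and II' says
  that d1 - (d4' - rstar r4') is the integral of ftilde from r4' to r1. Hence that integral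
  enters the formula for d4' with a minus sign, and likewise in the formula for d3.\<close>

definition ftilde :: "real \<Rightarrow> real \<Rightarrow> real \<Rightarrow> real \<Rightarrow> real" where
  "ftilde M H c r =
     - (r^4) / ((H * r^3 + c)^2 + r^3 * (r - 2 * M) +
                (H * r^3 + c) * sqrt ((H * r^3 + c)^2 + r^3 * (r - 2 * M)))"

end

theory Submission
  imports Defs
begin

text \<open>Along the graphs of f1 and f4ss the retarded time u = t - rstar has r-derivative ftilde,
  which is continuous across r = 2 M. Hence u has limits at the horizon V = 0 from both sides,
  and each limit determines a point of the closure of the union on that horizon, with
  U = exp (- u / (4 M)). A smooth connection allows only one sphere there, so the two limits
  agree; this is the first formula. At the horizon U = 0 the same argument applies to the advanced
  time v = t + rstar along f4s and f3. At the turning point ftilde blows up like an inverse square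
  root, because kH is strictly decreasing beyond its maximum with nonzero derivative.\<close>

section \<open>Points near the horizons\<close>

text \<open>The derivative is z / (2 M) exp (z / (2 M)), which is positive for z > 0. So the
  equation defining the area radius has at most one positive solution, and exhibiting one determines
  \<open>area_radius\<close>.\<close>

lemma area_strict_mono:
  fixes M x y :: real
  assumes "M > 0" "0 \<le> x" "x < y"
  shows "(x - 2 * M) * exp (x / (2 * M)) < (y - 2 * M) * exp (y / (2 * M))"
proof (rule DERIV_pos_imp_increasing_open[OF assms(3)])
  fix z assume "x < z" "z < y"
  then show "\<exists>d. ((\<lambda>r. (r - 2 * M) * exp (r / (2 * M))) has_real_derivative d) (at z) \<and> 0 < d"
    using assms by (intro exI[of _ "z / (2 * M) * exp (z / (2 * M))"] conjI)
      (auto intro!: derivative_eq_intros simp: field_simps)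
qed (intro continuous_intros, use assms in auto)

lemma area_radius_eqI:
  assumes "M > 0" "r > 0" "U * V = (r - 2 * M) * exp (r / (2 * M))"
  shows "area_radius M (U, V, w) = r"
  unfolding area_radius_def prod.case
proof (rule the_equality)
  fix s assume s: "s > 0 \<and> (s - 2 * M) * exp (s / (2 * M)) = U * V"
  then show "s = r"
    using area_strict_mono[OF assms(1), of r s] area_strict_mono[OF assms(1), of s r] assms
    by (cases s r rule: linorder_cases) auto
qed (use assms in auto)

text \<open>The point of Schwarzschild time t and area radius r in the quadrant with signs i and j.\<close>

definition schw_point :: "real \<Rightarrow> real \<Rightarrow> real \<Rightarrow> real \<Rightarrow> real \<Rightarrow> real ^ 3 \<Rightarrow> kpoint" where
  "schw_point M i j t r w =
     (i * exp (- (t - rstar M r) / (4 * M)), j * exp ((t + rstar M r) / (4 * M)), w)"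

lemma exp_rstar:
  assumes "M > 0" "r \<noteq> 2 * M"
  shows "exp (rstar M r / (2 * M)) = exp (r / (2 * M)) * \<bar>r - 2 * M\<bar>"
proof -
  have "rstar M r / (2 * M) = r / (2 * M) + ln \<bar>r - 2 * M\<bar>"
    using assms by (simp add: rstar_def field_simps)
  then show ?thesis using assms by (simp add: exp_add)
qed

text \<open>The product U V is i j exp (rstar / (2 M)) = i j exp (r / (2 M)) |r - 2 M|. The sign
  condition on i j removes the absolute value, which treats all four quadrants at once.\<close>

lemma schw_point:
  assumes M: "M > 0" and r: "r > 0" "r \<noteq> 2 * M" and ij: "i \<noteq> 0" "j \<noteq> 0" "i * j = sgn (r - 2 * M)"
    and "\<bar>i\<bar> = \<bar>j\<bar>" and w: "w \<in> sphere 0 1"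
  shows "schw_point M i j t r w \<in> kruskal M"
    and "area_radius M (schw_point M i j t r w) = r"
    and "schw_time M (schw_point M i j t r w) = t"
proof -
  define U where "U = i * exp (- (t - rstar M r) / (4 * M))"
  define V where "V = j * exp ((t + rstar M r) / (4 * M))"
  have p: "schw_point M i j t r w = (U, V, w)"
    by (simp add: schw_point_def U_def V_def)
  have "exp (- (t - rstar M r) / (4 * M)) * exp ((t + rstar M r) / (4 * M)) = exp (rstar M r / (2 * M))"
    unfolding exp_add[symmetric] using M by (simp add: field_simps)
  then have "U * V = (i * j) * (exp (r / (2 * M)) * \<bar>r - 2 * M\<bar>)"
    using exp_rstar[OF M r(2)] by (simp add: U_def V_def)
  also have "\<dots> = (r - 2 * M) * exp (r / (2 * M))"
    unfolding ij(3) by (auto simp: sgn_if)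
  finally have UV: "U * V = (r - 2 * M) * exp (r / (2 * M))" .
  show "area_radius M (schw_point M i j t r w) = r"
    unfolding p using area_radius_eqI[OF M r(1) UV] .
  have "- 2 * M < U * V"
    using area_strict_mono[OF M order_refl r(1)] UV by simp
  then show "schw_point M i j t r w \<in> kruskal M"
    unfolding p kruskal_def using w by simp
  have "V / U = (j / i) * exp ((t + rstar M r) / (4 * M) - - (t - rstar M r) / (4 * M))"
    unfolding U_def V_def exp_diff by simp
  also have "(t + rstar M r) / (4 * M) - - (t - rstar M r) / (4 * M) = t / (2 * M)"
    using M by (simp add: field_simps)
  finally have "\<bar>V / U\<bar> = exp (t / (2 * M))"
    using ij assms(7) by (simp add: abs_mult)
  then show "schw_time M (schw_point M i j t r w) = t"
    unfolding p schw_time_def using M by simp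
qed

text \<open>Here U = i exp (- u / (4 M)) converges, while V is j exp (u / (4 M)) times a factor
  containing |r - 2 M| and tends to 0. Writing V this way avoids the divergence of
  \<open>rstar\<close>. The filter allows the approach from either side.\<close>

lemma horizon_limit_u:
  assumes M: "M > 0" and F: "F \<noteq> bot" "F \<le> at (2 * M)"
    and lim: "((\<lambda>r. f r - rstar M r) \<longlongrightarrow> u) F"
    and S: "\<forall>\<^sub>F r in F. schw_point M i j (f r) r w \<in> S"
  shows "(i * exp (- u / (4 * M)), 0, w) \<in> closure S"
proof -
  have id: "((\<lambda>r. r) \<longlongrightarrow> 2 * M) F"
    using F(2) tendsto_ident_at tendsto_mono by blast
  have ne: "\<forall>\<^sub>F r in F. r \<noteq> 2 * M"
    using filter_leD[OF F(2)] by (simp add: eventually_at_filter)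
  have "((\<lambda>r. (i * exp (- (f r - rstar M r) / (4 * M)),
          j * (exp ((f r - rstar M r) / (4 * M)) * (exp (r / (2 * M)) * \<bar>r - 2 * M\<bar>)), w))
      \<longlongrightarrow> (i * exp (- u / (4 * M)),
          j * (exp (u / (4 * M)) * (exp ((2 * M) / (2 * M)) * \<bar>2 * M - 2 * M\<bar>)), w)) F"
    using M by (intro tendsto_intros lim id) auto
  moreover have "\<forall>\<^sub>F r in F. (i * exp (- (f r - rstar M r) / (4 * M)),
          j * (exp ((f r - rstar M r) / (4 * M)) * (exp (r / (2 * M)) * \<bar>r - 2 * M\<bar>)), w)
        = schw_point M i j (f r) r w"
    using ne
  proof eventually_elim
    case (elim r)
    have "exp ((f r - rstar M r) / (4 * M)) * (exp (r / (2 * M)) * \<bar>r - 2 * M\<bar>)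
        = exp ((f r + rstar M r) / (4 * M))"
      unfolding exp_rstar[OF M elim, symmetric] exp_add[symmetric] using M by (simp add: field_simps)
    then show ?case by (simp add: schw_point_def)
  qed
  ultimately have "((\<lambda>r. schw_point M i j (f r) r w) \<longlongrightarrow> (i * exp (- u / (4 * M)), 0, w)) F"
    using Lim_transform_eventually by fastforce
  moreover have "\<forall>\<^sub>F r in F. schw_point M i j (f r) r w \<in> closure S"
    using S by eventually_elim (use closure_subset in blast)
  ultimately show ?thesis
    using Lim_in_closed_set[OF closed_closure _ F(1), where f = "\<lambda>r. schw_point M i j (f r) r w"]
    by simp
qed

lemma horizon_limit_v:
  assumes M: "M > 0" and F: "F \<noteq> bot" "F \<le> at (2 * M)"
    and lim: "((\<lambda>r. f r + rstar M r) \<longlongrightarrow> v) F"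
    and S: "\<forall>\<^sub>F r in F. schw_point M i j (f r) r w \<in> S"
  shows "(0, j * exp (v / (4 * M)), w) \<in> closure S"
proof -
  \<comment> \<open>The reflection that exchanges U and V reverses t, hence maps v to - u.\<close>
  define \<sigma> :: "kpoint \<Rightarrow> kpoint" where "\<sigma> = (\<lambda>(U, V, w). (V, U, w))"
  have cont: "continuous_on UNIV \<sigma>"
    unfolding \<sigma>_def case_prod_unfold by (intro continuous_intros)
  have "(j * exp (- (- v) / (4 * M)), 0, w) \<in> closure (\<sigma> ` S)"
  proof (rule horizon_limit_u[OF M F, where f = "\<lambda>r. - f r" and j = i])
    show "((\<lambda>r. - f r - rstar M r) \<longlongrightarrow> - v) F"
      using tendsto_minus[OF lim] by simp
    show "\<forall>\<^sub>F r in F. schw_point M j i (- f r) r w \<in> \<sigma> ` S"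
      using S
    proof eventually_elim
      case (elim r)
      have "schw_point M j i (- f r) r w = \<sigma> (schw_point M i j (f r) r w)"
        by (simp add: schw_point_def \<sigma>_def algebra_simps)
      then show ?case using elim by blast
    qed
  qed
  \<comment> \<open>Since \<open>\<sigma>\<close> is a continuous involution, a second application
    returns to the closure of \<open>S\<close>.\<close>
  then have "\<sigma> (j * exp (v / (4 * M)), 0, w) \<in> \<sigma> ` closure (\<sigma> ` S)"
    by simp
  also have "\<dots> \<subseteq> closure (\<sigma> ` \<sigma> ` S)"
    by (rule image_closure_subset) (auto intro: continuous_on_subset[OF cont] closure_subset[THEN subsetD])
  also have "\<sigma> ` \<sigma> ` S = S"
    by (force simp: \<sigma>_def image_def)
  finally show ?thesis by (simp add: \<sigma>_def)
qed

text \<open>The closure meets \<open>B\<close> in a single sphere over one pair (U, V), so two of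
  its points can differ only in the sphere component.\<close>

lemma connect_point_unique:
  assumes "connect_smoothly M B S S'" "p \<in> closure S" "q \<in> closure S'" "p \<in> B" "q \<in> B"
    "snd (snd p) = snd (snd q)"
  shows "p = q"
proof -
  obtain a b where "closure (S \<union> S') \<inter> B = {a} \<times> {b} \<times> sphere 0 1"
    using assms(1) unfolding connect_smoothly_def by blast
  moreover have "p \<in> closure (S \<union> S') \<inter> B" "q \<in> closure (S \<union> S') \<inter> B"
    using assms by (auto simp: closure_Un)
  ultimately show ?thesis using assms(6) by (auto simp: mem_Times_iff prod_eq_iff)
qed

section \<open>The shape of kH\<close>

lemma kH_eq:
  assumes "0 \<le> r" "r \<le> 2 * M"
  shows "kH M H r = sqrt (r^3 * (2 * M - r)) - H * r^3"
proof -
  have "r powr (3/2) = sqrt (r^3)"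
  proof (cases "r = 0")
    case False
    then have "r powr (3/2) = (r powr 3) powr (1/2)"
      unfolding powr_powr by simp
    also have "r powr 3 = r^3" using False assms by simp
    finally show ?thesis using assms by (simp add: powr_half_sqrt)
  qed simp
  then show ?thesis
    using assms by (simp add: kH_def powr_half_sqrt real_sqrt_mult)
qed

lemma sqrt_cubic_deriv:
  assumes "0 < r" "r < 2 * M"
  shows "((\<lambda>r. sqrt (r^3 * (2 * M - r))) has_real_derivative
    r^2 * (3 * M - 2 * r) / sqrt (r^3 * (2 * M - r))) (at r)"
proof -
  have Q: "r^3 * (2 * M - r) > 0" using assms by simp
  have "((\<lambda>r. r^3 * (2 * M - r)) has_real_derivative 2 * (r^2 * (3 * M - 2 * r))) (at r)"
    by (auto intro!: derivative_eq_intros simp: power2_eq_square power3_eq_cube algebra_simps)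
  from DERIV_chain2[OF DERIV_real_sqrt[OF Q] this]
  have "((\<lambda>r. sqrt (r^3 * (2 * M - r))) has_real_derivative
    inverse (sqrt (r^3 * (2 * M - r))) / 2 * (2 * (r^2 * (3 * M - 2 * r)))) (at r)" .
  also have "inverse (sqrt (r^3 * (2 * M - r))) / 2 * (2 * (r^2 * (3 * M - 2 * r)))
     = r^2 * (3 * M - 2 * r) / sqrt (r^3 * (2 * M - r))"
    by (simp only: divide_inverse) simp
  finally show ?thesis .
qed

text \<open>With r^2 factored out, the sign of the derivative is decided by comparing one function
  of r with the constant 3 H.\<close>

lemma kH_deriv:
  assumes "0 < r" "r < 2 * M"
  shows "(kH M H has_real_derivative
    r^2 * ((3 * M - 2 * r) / sqrt (r^3 * (2 * M - r)) - 3 * H)) (at r)"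
proof (rule has_field_derivative_transform_within_open[where S = "{0<..<2 * M}"])
  show "((\<lambda>r. sqrt (r^3 * (2 * M - r)) - H * r^3) has_real_derivative
      r^2 * ((3 * M - 2 * r) / sqrt (r^3 * (2 * M - r)) - 3 * H)) (at r)"
    by (rule derivative_eq_intros sqrt_cubic_deriv[OF assms] refl)+ (simp add: right_diff_distrib)
qed (use assms in \<open>auto simp: kH_eq\<close>)

text \<open>By the quotient rule the numerator of the derivative is -2 s minus a square divided by
  s, with s > 0. Hence the slope crosses the level 3 H at most once.\<close>

lemma kH_slope_antimono:
  fixes M :: real
  assumes "0 < a" "a < b" "b < 2 * M"
  shows "(3 * M - 2 * b) / sqrt (b^3 * (2 * M - b)) < (3 * M - 2 * a) / sqrt (a^3 * (2 * M - a))"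
proof (rule DERIV_neg_imp_decreasing[OF assms(2)])
  fix r assume "a \<le> r" "r \<le> b"
  then have r: "0 < r" "r < 2 * M" using assms by auto
  define s where "s = sqrt (r^3 * (2 * M - r))"
  have Q: "r^3 * (2 * M - r) > 0" using r by simp
  then have s: "s > 0" unfolding s_def by (rule real_sqrt_gt_zero)
  let ?n = "(- 2) * s - (3 * M - 2 * r) * (r^2 * (3 * M - 2 * r) / s)"
  have "((\<lambda>r. (3 * M - 2 * r) / sqrt (r^3 * (2 * M - r))) has_real_derivative ?n / (s * s)) (at r)"
    unfolding s_def
    by (rule DERIV_divide sqrt_cubic_deriv[OF r] derivative_eq_intros refl)+ (use r in simp_all)
  moreover have "?n < 0"
  proof -
    have "(3 * M - 2 * r) * (r^2 * (3 * M - 2 * r) / s) = (r * (3 * M - 2 * r))^2 / s"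
      by (simp add: power2_eq_square mult_ac)
    also have "\<dots> \<ge> 0" using s by simp
    finally show ?thesis using s by linarith
  qed
  then have "?n / (s * s) < 0" using s by (simp add: divide_neg_pos)
  ultimately show "\<exists>d. ((\<lambda>r. (3 * M - 2 * r) / sqrt (r^3 * (2 * M - r))) has_real_derivative d) (at r) \<and> d < 0"
    by blast
qed

text \<open>The critical equation, cleared of its denominator, has a root because the difference of
  its sides runs from -3 M at 0 to M at 2 M. Monotonicity of the slope then fixes the sign of the
  derivative on each side. The last conclusion is negativity of the derivative beyond R, free of
  denominators.\<close>

lemma kH_unimodal:
  assumes M: "M > 0"
  obtains R where "0 < R" "R < 2 * M"
    "\<And>a b. 0 < a \<Longrightarrow> a < b \<Longrightarrow> b \<le> R \<Longrightarrow> kH M H a < kH M H b"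
    "\<And>a b. R \<le> a \<Longrightarrow> a < b \<Longrightarrow> b \<le> 2 * M \<Longrightarrow> kH M H b < kH M H a"
    "\<And>r. R < r \<Longrightarrow> r < 2 * M \<Longrightarrow> 3 * M - 2 * r < 3 * H * sqrt (r^3 * (2 * M - r))"
proof -
  let ?q = "\<lambda>r. sqrt (r^3 * (2 * M - r))"
  have "\<exists>R\<ge>0. R \<le> 2 * M \<and> 3 * H * ?q R - (3 * M - 2 * R) = 0"
  proof (rule IVT'[where f = "\<lambda>R. 3 * H * ?q R - (3 * M - 2 * R)"])
    show "continuous_on {0..2 * M} (\<lambda>R. 3 * H * ?q R - (3 * M - 2 * R))"
      by (intro continuous_intros)
  qed (use M in simp_all)
  then obtain R where R: "0 \<le> R" "R \<le> 2 * M" and eq: "3 * H * ?q R = 3 * M - 2 * R" by auto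
  have "R \<noteq> 0" "R \<noteq> 2 * M" using eq M by auto
  then have R: "0 < R" "R < 2 * M" using R by auto
  have q: "?q r > 0" if "0 < r" "r < 2 * M" for r using that by simp
  have gR: "(3 * M - 2 * R) / ?q R = 3 * H"
    unfolding eq[symmetric] using q[OF R] by (intro nonzero_mult_div_cancel_right) linarith
  have cont: "continuous_on {0..2 * M} (kH M H)"
    by (rule continuous_on_eq[where f = "\<lambda>r. ?q r - H * r^3"])
      (auto intro!: continuous_intros simp: kH_eq)
  have 1: "kH M H a < kH M H b" if "0 < a" "a < b" "b \<le> R" for a b
  proof (rule DERIV_pos_imp_increasing_open[OF that(2)])
    fix x assume x: "a < x" "x < b"
    show "\<exists>y. (kH M H has_real_derivative y) (at x) \<and> 0 < y"
    proof (intro exI conjI)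
      show "(kH M H has_real_derivative x^2 * ((3 * M - 2 * x) / ?q x - 3 * H)) (at x)"
        using x that R by (intro kH_deriv) auto
      show "0 < x^2 * ((3 * M - 2 * x) / ?q x - 3 * H)"
        using kH_slope_antimono[of x R M] gR x that R by simp
    qed
  qed (use that R in \<open>auto intro: continuous_on_subset[OF cont]\<close>)
  have 2: "kH M H b < kH M H a" if "R \<le> a" "a < b" "b \<le> 2 * M" for a b
  proof (rule DERIV_neg_imp_decreasing_open[OF that(2)])
    fix x assume x: "a < x" "x < b"
    show "\<exists>y. (kH M H has_real_derivative y) (at x) \<and> y < 0"
    proof (intro exI conjI)
      show "(kH M H has_real_derivative x^2 * ((3 * M - 2 * x) / ?q x - 3 * H)) (at x)"
        using x that R by (intro kH_deriv) auto
      show "x^2 * ((3 * M - 2 * x) / ?q x - 3 * H) < 0"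
        using kH_slope_antimono[of R x M] gR x that R by (intro mult_pos_neg) simp_all
    qed
  qed (use that R in \<open>auto intro: continuous_on_subset[OF cont]\<close>)
  have 3: "3 * M - 2 * r < 3 * H * ?q r" if "R < r" "r < 2 * M" for r
    using kH_slope_antimono[of R r M] gR that R q[of r] by (simp add: pos_divide_less_eq)
  show ?thesis using that[OF R] 1 2 3 by blast
qed

lemma kH_2M: "M > 0 \<Longrightarrow> kH M H (2 * M) = - 8 * M^3 * H"
  by (simp add: kH_eq power_mult_distrib)

text \<open>If the left endpoint L belongs to the domain, it is the turning point, and the last
  inequality in the assumption on L says that kH has a negative derivative there.\<close>

locale cmc_domain =
  fixes M H c L :: real
  assumes M: "M > 0" and c: "c > - 8 * M^3 * H"
    and L: "0 \<le> L" "L < 2 * M"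
    and dom4: "{L<..<2*M} \<subseteq> dom4 M H c" "dom4 M H c \<subseteq> {L..<2*M}"
    and kH_less: "\<And>r. L < r \<Longrightarrow> r < 2 * M \<Longrightarrow> kH M H r < c"
    and turning: "L \<in> dom4 M H c \<Longrightarrow>
      0 < L \<and> kH M H L = c \<and> 3 * M - 2 * L < 3 * H * sqrt (L^3 * (2 * M - L))"
    and rturn: "c < CH M H \<Longrightarrow> rturn M H c = L \<and> L \<in> dom4 M H c"

text \<open>The endpoint L is 0, \<open>RH M H\<close> or the turning point, according to whether c
  is above, at or below \<open>CH M H\<close>. In the first two cases L lies outside the domain, so
  the condition at a turning point is vacuous.\<close>

lemma cmc_domain_exists:
  assumes M: "M > 0" and c: "c > - 8 * M^3 * H"
  obtains L where "cmc_domain M H c L"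
proof -
  obtain R where R: "0 < R" "R < 2 * M"
    and inc: "\<And>a b. 0 < a \<Longrightarrow> a < b \<Longrightarrow> b \<le> R \<Longrightarrow> kH M H a < kH M H b"
    and dec: "\<And>a b. R \<le> a \<Longrightarrow> a < b \<Longrightarrow> b \<le> 2 * M \<Longrightarrow> kH M H b < kH M H a"
    and slope: "\<And>r. R < r \<Longrightarrow> r < 2 * M \<Longrightarrow> 3 * M - 2 * r < 3 * H * sqrt (r^3 * (2 * M - r))"
    using kH_unimodal[OF M] by blast
  have max: "kH M H s < kH M H R" if "0 < s" "s < 2 * M" "s \<noteq> R" for s
    using inc[of s R] dec[of R s] that by (cases "s < R") auto
  have RH: "RH M H = R"
    unfolding RH_def
  proof (rule the_equality)
    show "R \<in> {0<..<2*M} \<and> (\<forall>s\<in>{0<..<2*M}. kH M H s \<le> kH M H R)"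
      using R max by force
    fix r assume "r \<in> {0<..<2*M} \<and> (\<forall>s\<in>{0<..<2*M}. kH M H s \<le> kH M H r)"
    then show "r = R" using R max[of r] by force
  qed
  consider "c > CH M H" | "c = CH M H" | "c < CH M H" by linarith
  then show ?thesis
  proof cases
    case 1
    have "kH M H r < c" if "0 < r" "r < 2 * M" for r
      using max[OF that] 1 by (cases "r = R") (auto simp: CH_def RH)
    then show ?thesis using 1 M c by (intro that[of 0]) (unfold_locales, auto simp: dom4_def)
  next
    case 2
    then show ?thesis using M c R max
      by (intro that[of R]) (unfold_locales, auto simp: dom4_def RH CH_def)
  next
    case 3
    \<comment> \<open>Here c lies strictly between the value of \<open>kH\<close> at 2 M and its
      maximum, so the decreasing branch attains it.\<close>
    have "\<exists>L\<ge>R. L \<le> 2 * M \<and> kH M H L = c"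
    proof (rule IVT2')
      show "continuous_on {R..2 * M} (kH M H)"
        by (rule continuous_on_eq[where f = "\<lambda>r. sqrt (r^3 * (2 * M - r)) - H * r^3"])
          (use R in \<open>auto intro!: continuous_intros simp: kH_eq\<close>)
    qed (use 3 c R M in \<open>auto simp: CH_def RH kH_2M\<close>)
    then obtain L where L: "R \<le> L" "L \<le> 2 * M" and k: "kH M H L = c" by blast
    have "L \<noteq> R" "L \<noteq> 2 * M" using k 3 c M by (auto simp: CH_def RH kH_2M)
    then have L: "R < L" "L < 2 * M" using L by auto
    have lt: "kH M H r < c" if "L < r" "r < 2 * M" for r
      using dec[of L r] that L k by simp
    have rt: "rturn M H c = L"
      unfolding rturn_def
    proof (rule the_equality)
      show "L \<in> {0<..<2*M} \<and> kH M H L = c \<and> (\<forall>s\<in>{L<..<2*M}. kH M H s < c)"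
        using L R k lt by auto
      fix r assume r: "r \<in> {0<..<2*M} \<and> kH M H r = c \<and> (\<forall>s\<in>{r<..<2*M}. kH M H s < c)"
      \<comment> \<open>For r < L the condition on r would give kH L < c, and for r > L the bound
        beyond L would give kH r < c.\<close>
      then show "r = L"
        using lt[of r] k L by (cases r L rule: linorder_cases) auto
    qed
    show ?thesis
      using M c 3 L R k lt slope[OF L] by (intro that[of L]) (unfold_locales, auto simp: dom4_def rt)
  qed
qed

section \<open>Integration of ftilde\<close>

text \<open>The primitive 2 sqrt (r - a) has finite limits at both ends, which suffices for a
  nonnegative integrand that blows up at a.\<close>

lemma set_integrable_inverse_sqrt:
  fixes a b :: real
  assumes "a < b"
  shows "set_integrable lborel {a<..<b} (\<lambda>r. 1 / sqrt (r - a))"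
proof -
  have "set_integrable lborel (einterval (ereal a) (ereal b)) (\<lambda>r. 1 / sqrt (r - a))"
  proof (rule interval_integral_FTC_nonneg(1)[where F = "\<lambda>r. 2 * sqrt (r - a)"])
    show "((\<lambda>r. 2 * sqrt (r - a)) has_real_derivative 1 / sqrt (x - a)) (at x)"
      if "ereal a < ereal x" for x
    proof -
      have "((\<lambda>r. sqrt (r - a)) has_real_derivative inverse (sqrt (x - a)) / 2 * 1) (at x)"
        by (rule DERIV_chain2[OF DERIV_real_sqrt]) (use that in \<open>auto intro!: derivative_eq_intros\<close>)
      from DERIV_cmult[OF this, of 2] show ?thesis
        by (simp add: inverse_eq_divide)
    qed
    show "isCont (\<lambda>r. 1 / sqrt (r - a)) x" if "ereal a < ereal x" for x
      using that by (auto intro!: continuous_intros)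
    have "((\<lambda>r. 2 * sqrt (r - a)) \<longlongrightarrow> 2 * sqrt (a - a)) (at_right a)"
      by (intro tendsto_intros)
    then show "(((\<lambda>r. 2 * sqrt (r - a)) \<circ> real_of_ereal) \<longlongrightarrow> 2 * sqrt (a - a)) (at_right (ereal a))"
      by (simp add: ereal_tendsto_simps)
    have "((\<lambda>r. 2 * sqrt (r - a)) \<longlongrightarrow> 2 * sqrt (b - a)) (at_left b)"
      by (intro tendsto_intros)
    then show "(((\<lambda>r. 2 * sqrt (r - a)) \<circ> real_of_ereal) \<longlongrightarrow> 2 * sqrt (b - a)) (at_left (ereal b))"
      by (simp add: ereal_tendsto_simps)
  qed (use assms in auto)
  then show ?thesis by simp
qed

section \<open>The tortoise coordinate as a primitive of 1 / h\<close>

lemma rstar_deriv: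
  assumes "r > 0" "r \<noteq> 2 * M"
  shows "(rstar M has_real_derivative 1 / h M r) (at r)"
proof -
  have "((\<lambda>r. r + 2 * M * ln \<bar>r - 2 * M\<bar>) has_real_derivative 1 + 2 * M * (1 / (r - 2 * M))) (at r)"
  proof (cases "r > 2 * M")
    case True
    have "((\<lambda>r. r + 2 * M * ln (r - 2 * M)) has_real_derivative 1 + 2 * M * (1 / (r - 2 * M))) (at r)"
      using True by (auto intro!: derivative_eq_intros)
    then show ?thesis
      by (rule has_field_derivative_transform_within_open[where S = "{2 * M<..}"]) (use True in auto)
  next
    case False
    then have "r < 2 * M" using assms by simp
    have "((\<lambda>r. r + 2 * M * ln (2 * M - r)) has_real_derivative 1 + 2 * M * (1 / (2 * M - r) * (- 1))) (at r)"
      using \<open>r < 2 * M\<close> by (auto intro!: derivative_eq_intros)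
    also have "1 / (2 * M - r) * (- 1) = 1 / (r - 2 * M)"
      using assms by (simp add: field_simps)
    finally show ?thesis
      by (rule has_field_derivative_transform_within_open[where S = "{..<2 * M}"])
        (use \<open>r < 2 * M\<close> in auto)
  qed
  moreover have "1 + 2 * M * (1 / (r - 2 * M)) = 1 / h M r"
    using assms by (simp add: h_def field_simps)
  ultimately show ?thesis
    unfolding rstar_def[abs_def] by simp
qed

lemma between_same_side:
  fixes x :: real
  assumes "a > 0" "b > 0" "(a < 2 * M \<and> b < 2 * M) \<or> (a > 2 * M \<and> b > 2 * M)"
    and "min a b \<le> x" "x \<le> max a b"
  shows "x > 0" "x \<noteq> 2 * M"
  using assms by (auto simp: min_def max_def split: if_splits)

lemma integral_inverse_h:
  fixes a b :: real
  assumes "a > 0" "b > 0" "(a < 2 * M \<and> b < 2 * M) \<or> (a > 2 * M \<and> b > 2 * M)"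
  shows "interval_lebesgue_integrable lborel (ereal a) (ereal b) (\<lambda>r. 1 / h M r)"
    and "(LBINT r=ereal a..ereal b. 1 / h M r) = rstar M b - rstar M a"
proof -
  note x = between_same_side[OF assms]
  have cont: "isCont (\<lambda>r. 1 / h M r) x" if "min a b \<le> x" "x \<le> max a b" for x
    unfolding h_def using x[OF that] by (intro continuous_intros) (auto simp: field_simps)
  show "interval_lebesgue_integrable lborel (ereal a) (ereal b) (\<lambda>r. 1 / h M r)"
    by (rule interval_integrable_isCont) (use cont in \<open>auto simp: ereal_min ereal_max\<close>)
  show "(LBINT r=ereal a..ereal b. 1 / h M r) = rstar M b - rstar M a"
  proof (rule interval_integral_FTC_finite)
    show "continuous_on {min a b..max a b} (\<lambda>r. 1 / h M r)"
      using cont by (auto intro: continuous_at_imp_continuous_on)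
    show "(rstar M has_vector_derivative 1 / h M r) (at r within {min a b..max a b})"
      if "min a b \<le> r" "r \<le> max a b" for r
      using rstar_deriv[OF x[OF that]]
      by (simp add: has_real_derivative_iff_has_vector_derivative has_vector_derivative_at_within)
  qed
qed

section \<open>Algebra and continuity of the integrands\<close>

context cmc_domain
begin

text \<open>Dividing by r^2 sqrt |h| gives \<open>l1\<close> outside the horizon and
  \<open>l4\<close> inside.\<close>

definition P :: "real \<Rightarrow> real" where "P r = H * r^3 + c"

text \<open>This is r^4 h (1 + l1^2) outside the horizon and r^4 (-h) (l4^2 - 1) inside, a single
  polynomial valid across r = 2 M.\<close>

definition disc :: "real \<Rightarrow> real" where "disc r = (P r)^2 + r^3 * (r - 2 * M)"

lemma ftilde_eq: "ftilde M H c r = - (r^4) / (sqrt (disc r) * (sqrt (disc r) + P r))" if "disc r \<ge> 0"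
  using that by (simp add: ftilde_def disc_def P_def algebra_simps)

lemma P_greater: "L < r \<Longrightarrow> r < 2 * M \<Longrightarrow> sqrt (r^3 * (2 * M - r)) < P r"
  using kH_less[of r] kH_eq[of r M H] L by (simp add: P_def)

text \<open>The lower bound on c enters here. At r = 2 M the root of \<open>disc\<close> is |P|, so
  its sum with \<open>P\<close> is nonzero only for positive \<open>P\<close>.\<close>

lemma P_2M: "P (2 * M) > 0"
  using c by (simp add: P_def power_mult_distrib mult_ac)

lemma disc_pos:
  assumes "L < r"
  shows "disc r > 0"
proof -
  consider "r < 2 * M" | "r = 2 * M" | "r > 2 * M" by linarith
  then show ?thesis
  proof cases
    case 1
    have "(sqrt (r^3 * (2 * M - r)))^2 < (P r)^2"
      using P_greater[OF assms 1] assms L 1 by (intro power_strict_mono) auto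
    then show ?thesis using assms L 1 by (simp add: disc_def algebra_simps)
  next
    case 2
    then show ?thesis using P_2M by (simp add: disc_def)
  next
    case 3
    then show ?thesis using M by (simp add: disc_def add_nonneg_pos)
  qed
qed

lemma P_pos:
  assumes "L < r" "r < 2 * M"
  shows "P r > 0"
proof -
  have "0 \<le> sqrt (r^3 * (2 * M - r))" using assms L by simp
  then show ?thesis using P_greater[OF assms] by linarith
qed

text \<open>Beyond the horizon \<open>P\<close> may be negative, but there \<open>disc\<close>
  exceeds P^2, so its root exceeds |P|. Up to the horizon both summands are positive.\<close>

lemma sqrt_disc_add_P_pos:
  assumes "L < r"
  shows "sqrt (disc r) + P r > 0"
proof -
  consider "r < 2 * M" | "r = 2 * M" | "r > 2 * M" by linarith
  then show ?thesis
  proof cases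
    case 3
    then have "(P r)^2 < disc r" using M by (simp add: disc_def)
    then have "\<bar>P r\<bar> < sqrt (disc r)" by (simp add: real_less_rsqrt)
    then show ?thesis by linarith
  qed (use P_pos P_2M disc_pos assms in \<open>auto intro: add_pos_pos\<close>)
qed

lemma isCont_ftilde: "L < r \<Longrightarrow> isCont (ftilde M H c) r"
proof -
  assume r: "L < r"
  have "isCont (\<lambda>r. - (r^4) / (disc r + P r * sqrt (disc r))) r"
  proof (rule isCont_divide)
    have "sqrt (disc r) * (sqrt (disc r) + P r) \<noteq> 0"
      using disc_pos[OF r] sqrt_disc_add_P_pos[OF r] by simp
    then show "disc r + P r * sqrt (disc r) \<noteq> 0"
      using disc_pos[OF r] by (simp add: algebra_simps)
  qed (auto simp: disc_def P_def intro!: continuous_intros)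
  then show ?thesis by (simp add: ftilde_def[abs_def] disc_def P_def)
qed

text \<open>Rationalisation: with s = sqrt (disc r), (s - P) (s + P) = r^4 h. Therefore r^4 / (s +
  P) = (s - P) / h, and \<open>ftilde\<close> equals P / (h s) - 1 / h.\<close>

lemma ftilde_add_inverse_h:
  assumes "L < r" "r \<noteq> 2 * M"
  shows "ftilde M H c r + 1 / h M r = P r / (h M r * sqrt (disc r))"
proof -
  have r: "r > 0" using assms L by simp
  have h: "h M r = (r - 2 * M) / r" using r by (simp add: h_def field_simps)
  define s where "s = sqrt (disc r)"
  have s: "s > 0" "s + P r > 0" using disc_pos sqrt_disc_add_P_pos assms by (auto simp: s_def)
  have s2: "s * s = (P r)^2 + r^3 * (r - 2 * M)"
    using disc_pos[OF assms(1)] by (simp add: s_def disc_def)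
  have "(s - P r) * (s + P r) = r^3 * (r - 2 * M)"
    using s2 by (simp add: algebra_simps power2_eq_square)
  then have "r^4 / (s + P r) = (s - P r) * (r / (r - 2 * M))"
  proof -
    have "r^4 / (s + P r) = r^3 * (r - 2 * M) * (r / (r - 2 * M)) / (s + P r)"
      using assms by (simp add: power4_eq_xxxx power3_eq_cube)
    also have "\<dots> = (s - P r) * (s + P r) * (r / (r - 2 * M)) / (s + P r)"
      by (simp only: \<open>(s - P r) * (s + P r) = r^3 * (r - 2 * M)\<close>)
    finally show ?thesis using s by simp
  qed
  moreover have "- (r^4) / (s * (s + P r)) = - (r^4 / (s + P r)) / s"
    by simp
  ultimately have "- (r^4) / (s * (s + P r)) = - ((s - P r) * (r / (r - 2 * M))) / s"
    by metis
  also have "\<dots> + r / (r - 2 * M) = P r / ((r - 2 * M) / r * s)"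
  proof -
    have *: "- ((s - P r) * y) / s + y = P r * y / s" for y
      using s by (simp add: field_simps)
    show ?thesis unfolding * by simp
  qed
  finally show ?thesis
    using ftilde_eq disc_pos[OF assms(1)] by (simp add: h s_def)
qed

lemma f1_integrand_eq:
  assumes "r > 2 * M"
  shows "l1 M H c r / h M r * (1 / sqrt (1 + (l1 M H c r)^2)) = ftilde M H c r + 1 / h M r"
proof -
  have r: "r > 0" "L < r" using assms M L by simp_all
  have h: "h M r = (r - 2 * M) / r" "h M r > 0" using r assms by (simp_all add: h_def field_simps)
  have l: "l1 M H c r = P r / (r^2 * sqrt (h M r))"
    using r by (simp add: l1_def P_def field_simps power2_eq_square power3_eq_cube)
  define q where "q = (r^2 * sqrt (h M r))^2"
  have q: "q = r^3 * (r - 2 * M)"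
    using h r unfolding q_def
    by (simp add: power_mult_distrib) (simp add: power4_eq_xxxx power3_eq_cube)
  have q0: "q > 0" unfolding q using r assms by simp
  have "1 + (l1 M H c r)^2 = (q + (P r)^2) / q"
    using q0 unfolding l by (simp add: power_divide add_divide_distrib flip: q_def)
  then have "1 + (l1 M H c r)^2 = disc r / (r^2 * sqrt (h M r))^2"
    by (simp add: disc_def q add.commute flip: q_def)
  then have "sqrt (1 + (l1 M H c r)^2) = sqrt (disc r) / (r^2 * sqrt (h M r))"
    using h(2) by (simp add: real_sqrt_divide)
  then have "l1 M H c r * (1 / sqrt (1 + (l1 M H c r)^2)) = P r / sqrt (disc r)"
    using h(2) r by (simp add: l)
  then have "l1 M H c r / h M r * (1 / sqrt (1 + (l1 M H c r)^2)) = P r / sqrt (disc r) / h M r"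
    by (simp add: divide_inverse mult_ac)
  then show ?thesis
    using ftilde_add_inverse_h[OF r(2)] assms by (simp add: mult.commute)
qed

text \<open>The radicand is P^2 / disc, and positivity of \<open>P\<close> inside the horizon lets
  its root be taken without an absolute value.\<close>

lemma f4ss_integrand_eq:
  assumes "L < r" "r < 2 * M"
  shows "1 / h M r * sqrt ((l4 M H c r)^2 / ((l4 M H c r)^2 - 1)) = ftilde M H c r + 1 / h M r"
proof -
  have r: "r > 0" using assms M L by simp
  have h: "- h M r = (2 * M - r) / r" "- h M r > 0" using r assms by (simp_all add: h_def field_simps)
  have l: "l4 M H c r = P r / (r^2 * sqrt (- h M r))"
    using r by (simp add: l4_def P_def field_simps power2_eq_square power3_eq_cube)
  define q where "q = (r^2 * sqrt (- h M r))^2"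
  have q: "q = r^3 * (2 * M - r)"
    using h r unfolding q_def
    by (simp add: power_mult_distrib) (simp add: power4_eq_xxxx power3_eq_cube)
  have q0: "q > 0" unfolding q using r assms by simp
  have l2: "(l4 M H c r)^2 = (P r)^2 / q" by (simp add: l power_divide q_def)
  have "(l4 M H c r)^2 - 1 = disc r / q"
  proof -
    have "disc r = (P r)^2 - q" by (simp add: disc_def q algebra_simps)
    then show ?thesis using q0 by (simp add: l2 diff_divide_distrib)
  qed
  then have "(l4 M H c r)^2 / ((l4 M H c r)^2 - 1) = (P r)^2 / disc r"
    using q0 by (simp add: l2)
  then have "sqrt ((l4 M H c r)^2 / ((l4 M H c r)^2 - 1)) = P r / sqrt (disc r)"
    using P_pos[OF assms] by (simp add: real_sqrt_divide)
  then show ?thesis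
    using ftilde_add_inverse_h[OF assms(1)] assms by simp
qed

text \<open>At a turning point disc has a simple zero, so ftilde is bounded by a multiple of the
  inverse square root of the distance to L.\<close>

lemma ftilde_integrable_turning:
  assumes Ld: "L \<in> dom4 M H c" and b: "L < b"
  shows "set_integrable lborel {L<..<b} (ftilde M H c)"
proof -
  have L0: "0 < L" and k: "kH M H L = c" and slope: "3 * M - 2 * L < 3 * H * sqrt (L^3 * (2 * M - L))"
    using turning[OF Ld] by auto
  have PL: "P L = sqrt (L^3 * (2 * M - L))"
    using k kH_eq[of L M H] L by (simp add: P_def)
  then have PL0: "P L > 0" using L0 L by simp
  have discL: "disc L = 0"
    using L0 L by (simp add: disc_def PL) (simp add: algebra_simps)
  \<comment> \<open>The quotient of disc r - disc L by r - L, expanded power by power. Its value at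
    L is the derivative of \<open>disc\<close> there, which is positive by the slope condition on
    \<open>kH\<close>.\<close>
  define E where "E r = H^2 * (r^5 + r^4 * L + r^3 * L^2 + r^2 * L^3 + r * L^4 + L^5)
    + 2 * (H * c - M) * (r^2 + r * L + L^2) + (r^3 + r^2 * L + r * L^2 + L^3)" for r
  have "disc r - disc L = (r - L) * E r" for r
    unfolding disc_def P_def E_def by algebra
  then have disc_E: "disc r = (r - L) * E r" for r by (simp add: discL)
  have "E L = 2 * L^2 * (3 * H * P L - (3 * M - 2 * L))"
    unfolding E_def P_def by algebra
  also have "\<dots> > 0" using L0 slope PL by simp
  finally have "E L > 0" .
  moreover have "E r > 0" if "r > L" for r
    using disc_pos[OF that] that by (simp add: disc_E zero_less_mult_iff)
  ultimately have E: "E r > 0" if "r \<ge> L" for r using that by (cases "r = L") auto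
  have sum: "sqrt (disc r) + P r > 0" if "r \<ge> L" for r
    using that sqrt_disc_add_P_pos[of r] PL0 discL by (cases "r = L") auto
  \<comment> \<open>Up to sign, the factor left after extracting 1 / sqrt (r - L) from
    \<open>ftilde\<close>. It is continuous up to L, hence bounded.\<close>
  define \<psi> where "\<psi> r = r^4 / (sqrt (E r) * (sqrt (disc r) + P r))" for r
  have "continuous_on {L..b} \<psi>"
    unfolding \<psi>_def
  proof (rule continuous_on_divide)
    show "continuous_on {L..b} (\<lambda>r. sqrt (E r) * (sqrt (disc r) + P r))"
      unfolding E_def disc_def P_def by (intro continuous_intros)
    show "\<forall>r\<in>{L..b}. sqrt (E r) * (sqrt (disc r) + P r) \<noteq> 0"
      using E sum by force
  qed (intro continuous_intros)
  then have "bounded (\<psi> ` {L..b})"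
    using compact_continuous_image compact_imp_bounded by blast
  then obtain C where "\<forall>y\<in>\<psi> ` {L..b}. norm y \<le> C"
    unfolding bounded_iff by blast
  then have C: "\<bar>\<psi> r\<bar> \<le> C" if "r \<in> {L..b}" for r
    using that by auto
  have bound: "\<bar>ftilde M H c r\<bar> \<le> \<bar>C * (1 / sqrt (r - L))\<bar>" if "r \<in> {L<..<b}" for r
  proof -
    have "ftilde M H c r = - \<psi> r * (1 / sqrt (r - L))"
      using disc_pos[of r] that
      by (simp add: ftilde_eq \<psi>_def disc_E[of r] real_sqrt_mult mult_ac flip: disc_E)
    then show ?thesis
      using C[of r] that by (auto simp: abs_mult intro!: divide_right_mono)
  qed
  show ?thesis
  proof (rule set_integrable_bound)
    show "set_integrable lborel {L<..<b} (\<lambda>r. C * (1 / sqrt (r - L)))"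
      by (intro set_integrable_mult_right set_integrable_inverse_sqrt b)
    have "continuous_on {L<..<b} (ftilde M H c)"
      by (auto intro!: continuous_at_imp_continuous_on isCont_ftilde)
    then show "set_borel_measurable lborel {L<..<b} (ftilde M H c)"
      unfolding set_borel_measurable_def
      by (auto intro!: borel_measurable_continuous_on_indicator simp del: real_scaleR_def)
    show "AE r in lborel. r \<in> {L<..<b} \<longrightarrow>
        norm (ftilde M H c r) \<le> norm (C * (1 / sqrt (r - L)))"
      using bound by auto
  qed
qed

text \<open>A primitive on all of (L, \<infinity>), chosen once. Its continuity at 2 M carries
  information from one side of the horizon to the other.\<close>

definition G :: "real \<Rightarrow> real" where
  "G = (SOME G. \<forall>r>L. (G has_real_derivative ftilde M H c r) (at r))"

lemma G_deriv: "L < r \<Longrightarrow> (G has_real_derivative ftilde M H c r) (at r)"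
proof -
  have "\<exists>G. \<forall>r::real. ereal L < ereal r \<longrightarrow> ereal r < \<infinity> \<longrightarrow> (G has_vector_derivative ftilde M H c r) (at r)"
    by (rule einterval_antiderivative) (auto intro: isCont_ftilde)
  then have "\<exists>G. \<forall>r>L. (G has_real_derivative ftilde M H c r) (at r)"
    by (simp add: has_real_derivative_iff_has_vector_derivative)
  from someI_ex[OF this] show "L < r \<Longrightarrow> (G has_real_derivative ftilde M H c r) (at r)"
    unfolding G_def by blast
qed

lemma ftilde_integral_inner:
  assumes "L < a" "L < b"
  shows "interval_lebesgue_integrable lborel (ereal a) (ereal b) (ftilde M H c)"
    and "(LBINT r=ereal a..ereal b. ftilde M H c r) = G b - G a"
proof -
  have x: "L < x" if "min a b \<le> x" for x using that assms by (auto simp: min_def split: if_splits)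
  show "interval_lebesgue_integrable lborel (ereal a) (ereal b) (ftilde M H c)"
    by (rule interval_integrable_isCont) (use x isCont_ftilde in \<open>auto simp: ereal_min\<close>)
  show "(LBINT r=ereal a..ereal b. ftilde M H c r) = G b - G a"
  proof (rule interval_integral_FTC_finite)
    show "continuous_on {min a b..max a b} (ftilde M H c)"
      using x isCont_ftilde by (auto intro: continuous_at_imp_continuous_on)
    show "(G has_vector_derivative ftilde M H c r) (at r within {min a b..max a b})"
      if "min a b \<le> r" for r
      using G_deriv[OF x[OF that]]
      by (simp add: has_real_derivative_iff_has_vector_derivative has_vector_derivative_at_within)
  qed
qed

text \<open>The constant \<open>K\<close> replaces \<open>G a\<close>, because at a turning point a
  = L nothing is known about the value of \<open>G\<close>. In that case the integral is split at 2
  M.\<close>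

lemma ftilde_integral:
  assumes a: "a \<in> dom4 M H c"
  obtains K where "\<And>b. L < b \<Longrightarrow> interval_lebesgue_integrable lborel (ereal a) (ereal b) (ftilde M H c)"
    and "\<And>b. L < b \<Longrightarrow> (LBINT r=ereal a..ereal b. ftilde M H c r) = G b - K"
proof (cases "L < a")
  case True
  then show ?thesis using ftilde_integral_inner[OF True] that[of "G a"] by blast
next
  case False
  then have [simp]: "a = L" using a dom4(2) by force
  have int: "interval_lebesgue_integrable lborel (ereal L) (ereal b) (ftilde M H c)" if "L < b" for b
    using ftilde_integrable_turning[OF _ that] a that by (simp add: interval_lebesgue_integrable_def)
  have "(LBINT r=ereal L..ereal b. ftilde M H c r)
      = G b - (G (2 * M) - (LBINT r=ereal L..ereal (2 * M). ftilde M H c r))" if "L < b" for b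
  proof -
    have "(LBINT r=ereal L..ereal (2 * M). ftilde M H c r)
        + (LBINT r=ereal (2 * M)..ereal b. ftilde M H c r) = (LBINT r=ereal L..ereal b. ftilde M H c r)"
    proof (rule interval_integral_sum)
      have "min (ereal L) (min (ereal (2 * M)) (ereal b)) = ereal L"
        "max (ereal L) (max (ereal (2 * M)) (ereal b)) = ereal (max (2 * M) b)"
        using that L by (simp_all add: min_def max_def)
      then show "interval_lebesgue_integrable lborel (min (ereal L) (min (ereal (2 * M)) (ereal b)))
        (max (ereal L) (max (ereal (2 * M)) (ereal b))) (ftilde M H c)"
        using int[of "max (2 * M) b"] that by simp
    qed
    then show ?thesis using ftilde_integral_inner(2)[OF L(2) that] by simp
  qed
  then show ?thesis
    using int that[of "G (2 * M) - (LBINT r=ereal L..ereal (2 * M). ftilde M H c r)"] by simp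
qed

text \<open>The endpoints lie on one side of the horizon, so 1 / h is integrable and can be split
  off. Equality on the open interval suffices, which admits a singular endpoint.\<close>

lemma integral_u:
  fixes a b :: real
  assumes "a > 0" "b > 0" "(a < 2 * M \<and> b < 2 * M) \<or> (a > 2 * M \<and> b > 2 * M)"
    and int: "interval_lebesgue_integrable lborel (ereal a) (ereal b) (ftilde M H c)"
    and eq: "\<And>r. min a b < r \<Longrightarrow> r < max a b \<Longrightarrow> f r = ftilde M H c r + 1 / h M r"
  shows "(LBINT r=ereal a..ereal b. f r)
    = (LBINT r=ereal a..ereal b. ftilde M H c r) + (rstar M b - rstar M a)"
proof -
  have "(LBINT r=ereal a..ereal b. f r) = (LBINT r=ereal a..ereal b. ftilde M H c r + 1 / h M r)"
    by (rule interval_integral_cong) (use eq in \<open>auto simp: einterval_iff min_def max_def split: if_splits\<close>)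
  also have "\<dots> = (LBINT r=ereal a..ereal b. ftilde M H c r) + (LBINT r=ereal a..ereal b. 1 / h M r)"
    by (rule interval_lebesgue_integral_add(2)[OF int integral_inverse_h(1)[OF assms(1-3)]])
  finally show ?thesis using integral_inverse_h(2)[OF assms(1-3)] by simp
qed

section \<open>Retarded and advanced time along the graphs\<close>

lemma f1_u:
  assumes "r1 > 2 * M" "r > 2 * M"
  shows "f1 M H c r1 d r = rstar M r + d - rstar M r1 + (G r - G r1)"
proof -
  have "L < r1" "L < r" using assms L by auto
  note i = ftilde_integral_inner[OF this]
  show ?thesis
    unfolding f1_def
    by (subst integral_u) (use assms M i f1_integrand_eq in \<open>auto simp: min_def split: if_splits\<close>)
qed

text \<open>Time reversal turns statements on u along \<open>f1\<close> into statements on v along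
  \<open>f3\<close>; the next lemma does the same for the two branches of
  \<open>Sigma4\<close>.\<close>

lemma f3_eq: "f3 M H c r3 d r = - f1 M H c r3 (- d) r"
  by (simp add: f1_def f3_def l3_def interval_lebesgue_integral_uminus)

lemma f4s_eq: "f4s M H c a d r = - f4ss M H c a (- d) r"
  by (simp add: f4s_def f4ss_def interval_lebesgue_integral_uminus)

lemma f4ss_u:
  assumes a: "a \<in> dom4 M H c"
    and r: "L < r" "r < 2 * M"
    and int: "interval_lebesgue_integrable lborel (ereal a) (ereal r) (ftilde M H c)"
  shows "f4ss M H c a d r = rstar M r + d - rstar M a + (LBINT r=ereal a..ereal r. ftilde M H c r)"
proof -
  have "a < 2 * M" "a \<ge> L" using a dom4(2) by auto
  \<comment> \<open>If a = L, then L is a turning point and therefore positive.\<close>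
  moreover have "a > 0" using a turning L calculation by (cases "a = L") auto
  ultimately show ?thesis
    unfolding f4ss_def
    by (subst integral_u) (use r L int f4ss_integrand_eq in \<open>auto simp: min_def max_def split: if_splits\<close>)
qed

section \<open>Limit spheres on the horizons\<close>

lemma G_tendsto: "(G \<longlongrightarrow> G (2 * M)) (at (2 * M) within S)"
  using DERIV_isCont[OF G_deriv[OF L(2)]] by (auto simp: isCont_def intro: tendsto_within_subset)

text \<open>The vector \<open>axis 1 1\<close> is a fixed sample point of the unit sphere. Using it
  on every hypersurface makes the limit points comparable.\<close>

lemma schw_point_time_graph:
  assumes "r > 0" "r \<noteq> 2 * M" "r \<in> D" "i * j = sgn (r - 2 * M)" "\<bar>i\<bar> = 1" "\<bar>j\<bar> = 1"
    and "schw_point M i j (f r) r (axis 1 1) \<in> R \<longleftrightarrow>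
      schw_point M i j (f r) r (axis 1 1) \<in> kruskal M"
  shows "schw_point M i j (f r) r (axis 1 1) \<in> time_graph M R D f"
  using assms schw_point[OF M assms(1,2) _ _ assms(4), of "axis 1 1" "f r"]
  unfolding time_graph_def by fastforce

text \<open>Since \<open>rstar\<close> vanishes at r1, u along the graph is d + G r - G r1, which
  converges as r decreases to 2 M.\<close>

lemma Sigma1_horizon:
  assumes "r1 > 2 * M" "rstar M r1 = 0"
  shows "(exp (- (d + G (2 * M) - G r1) / (4 * M)), 0, axis 1 1) \<in> closure (Sigma1 M H c r1 d)"
proof -
  have ev: "\<forall>\<^sub>F r in at_right (2 * M). r > 2 * M"
    by (simp add: eventually_at_right_less)
  have "(1 * exp (- (d + G (2 * M) - G r1) / (4 * M)), 0, axis 1 1) \<in> closure (Sigma1 M H c r1 d)"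
  proof (rule horizon_limit_u[OF M _ _ _, where F = "at_right (2 * M)" and f = "f1 M H c r1 d" and j = 1])
    have "((\<lambda>r. d + G r - G r1) \<longlongrightarrow> d + G (2 * M) - G r1) (at_right (2 * M))"
      by (intro tendsto_intros G_tendsto)
    then show "((\<lambda>r. f1 M H c r1 d r - rstar M r) \<longlongrightarrow> d + G (2 * M) - G r1) (at_right (2 * M))"
      by (rule Lim_transform_eventually)
        (use ev in eventually_elim, use f1_u[OF assms(1)] assms(2) in simp)
    show "\<forall>\<^sub>F r in at_right (2 * M).
        schw_point M 1 1 (f1 M H c r1 d r) r (axis 1 1) \<in> Sigma1 M H c r1 d"
      using ev
    proof eventually_elim
      case (elim r)
      then show ?case
        unfolding Sigma1_def using M
        by (intro schw_point_time_graph) (auto simp: region_I_def schw_point_def)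
    qed
  qed (auto simp: at_le)
  then show ?thesis by simp
qed

lemma Sigma3_horizon:
  assumes "r3 > 2 * M" "rstar M r3 = 0"
  shows "(0, - exp ((d - (G (2 * M) - G r3)) / (4 * M)), axis 1 1) \<in> closure (Sigma3 M H c r3 d)"
proof -
  have ev: "\<forall>\<^sub>F r in at_right (2 * M). r > 2 * M"
    by (simp add: eventually_at_right_less)
  have "(0, (- 1) * exp ((d - (G (2 * M) - G r3)) / (4 * M)), axis 1 1) \<in> closure (Sigma3 M H c r3 d)"
  proof (rule horizon_limit_v[OF M _ _ _, where F = "at_right (2 * M)" and f = "f3 M H c r3 d" and i = "- 1"])
    have "((\<lambda>r. d - (G r - G r3)) \<longlongrightarrow> d - (G (2 * M) - G r3)) (at_right (2 * M))"
      by (intro tendsto_intros G_tendsto)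
    then show "((\<lambda>r. f3 M H c r3 d r + rstar M r) \<longlongrightarrow> d - (G (2 * M) - G r3)) (at_right (2 * M))"
      by (rule Lim_transform_eventually)
        (use ev in eventually_elim, use f1_u[OF assms(1)] assms(2) f3_eq in simp)
    show "\<forall>\<^sub>F r in at_right (2 * M).
        schw_point M (- 1) (- 1) (f3 M H c r3 d r) r (axis 1 1) \<in> Sigma3 M H c r3 d"
      using ev
    proof eventually_elim
      case (elim r)
      then show ?case
        unfolding Sigma3_def using M
        by (intro schw_point_time_graph) (auto simp: region_I'_def schw_point_def)
    qed
  qed (auto simp: at_le)
  then show ?thesis by simp
qed

lemma eventually_left: "\<forall>\<^sub>F r in at_left (2 * M). L < r \<and> r < 2 * M"
  using eventually_at_left_real[OF L(2)] by (auto elim: eventually_mono)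

text \<open>The branch \<open>f4ss\<close> has convergent u and so approaches the horizon V =
  0.\<close>

lemma Sigma4_horizon_u:
  assumes a: "a \<in> dom4 M H c"
    and K: "\<And>b. L < b \<Longrightarrow> interval_lebesgue_integrable lborel (ereal a) (ereal b) (ftilde M H c)"
      "\<And>b. L < b \<Longrightarrow> (LBINT r=ereal a..ereal b. ftilde M H c r) = G b - K"
  shows "(exp (- (d - rstar M a + (G (2 * M) - K)) / (4 * M)), 0, axis 1 1)
    \<in> closure (Sigma4 M H c r4 d4 a d)"
proof -
  have "(1 * exp (- (d - rstar M a + (G (2 * M) - K)) / (4 * M)), 0, axis 1 1)
    \<in> closure (Sigma4 M H c r4 d4 a d)"
  proof (rule horizon_limit_u[OF M _ _ _, where F = "at_left (2 * M)" and f = "f4ss M H c a d" and j = "- 1"])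
    have "((\<lambda>r. d - rstar M a + (G r - K)) \<longlongrightarrow> d - rstar M a + (G (2 * M) - K)) (at_left (2 * M))"
      by (intro tendsto_intros G_tendsto)
    then show "((\<lambda>r. f4ss M H c a d r - rstar M r) \<longlongrightarrow> d - rstar M a + (G (2 * M) - K)) (at_left (2 * M))"
      by (rule Lim_transform_eventually)
        (use eventually_left in eventually_elim, use f4ss_u[OF a] K in simp)
    show "\<forall>\<^sub>F r in at_left (2 * M).
        schw_point M 1 (- 1) (f4ss M H c a d r) r (axis 1 1) \<in> Sigma4 M H c r4 d4 a d"
      using eventually_left
    proof eventually_elim
      case (elim r)
      then have "schw_point M 1 (- 1) (f4ss M H c a d r) r (axis 1 1)
          \<in> time_graph M (region_II' M) (dom4 M H c) (f4ss M H c a d)"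
        using L dom4(1) by (intro schw_point_time_graph) (auto simp: region_II'_def schw_point_def)
      then show ?case by (simp add: Sigma4_def)
    qed
  qed (auto simp: at_le)
  then show ?thesis by simp
qed

text \<open>The branch \<open>f4s\<close> has convergent v and approaches U = 0. It belongs to
  \<open>Sigma4\<close> only for c below \<open>CH M H\<close>.\<close>

lemma Sigma4_horizon_v:
  assumes a: "a \<in> dom4 M H c" and "c < CH M H"
    and K: "\<And>b. L < b \<Longrightarrow> interval_lebesgue_integrable lborel (ereal a) (ereal b) (ftilde M H c)"
      "\<And>b. L < b \<Longrightarrow> (LBINT r=ereal a..ereal b. ftilde M H c r) = G b - K"
  shows "(0, - exp ((d + rstar M a - (G (2 * M) - K)) / (4 * M)), axis 1 1)
    \<in> closure (Sigma4 M H c a d r4' d4')"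
proof -
  have "(0, (- 1) * exp ((d + rstar M a - (G (2 * M) - K)) / (4 * M)), axis 1 1)
    \<in> closure (Sigma4 M H c a d r4' d4')"
  proof (rule horizon_limit_v[OF M _ _ _, where F = "at_left (2 * M)" and f = "f4s M H c a d" and i = 1])
    have "((\<lambda>r. d + rstar M a - (G r - K)) \<longlongrightarrow> d + rstar M a - (G (2 * M) - K)) (at_left (2 * M))"
      by (intro tendsto_intros G_tendsto)
    then show "((\<lambda>r. f4s M H c a d r + rstar M r) \<longlongrightarrow> d + rstar M a - (G (2 * M) - K)) (at_left (2 * M))"
      by (rule Lim_transform_eventually)
        (use eventually_left in eventually_elim, use f4ss_u[OF a] K f4s_eq in simp)
    show "\<forall>\<^sub>F r in at_left (2 * M).
        schw_point M 1 (- 1) (f4s M H c a d r) r (axis 1 1) \<in> Sigma4 M H c a d r4' d4'"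
      using eventually_left
    proof eventually_elim
      case (elim r)
      then have "schw_point M 1 (- 1) (f4s M H c a d r) r (axis 1 1)
          \<in> time_graph M (region_II' M) (dom4 M H c) (f4s M H c a d)"
        using L dom4(1) by (intro schw_point_time_graph) (auto simp: region_II'_def schw_point_def)
      then show ?case using assms(2) by (simp add: Sigma4_def)
    qed
  qed (auto simp: at_le)
  then show ?thesis by simp
qed

lemma f1_deriv:
  assumes "r1 > 2 * M" "r > 2 * M"
  shows "(f1 M H c r1 d has_real_derivative ftilde M H c r + 1 / h M r) (at r)"
proof (rule has_field_derivative_transform_within_open[where S = "{2 * M<..}"])
  show "((\<lambda>r. rstar M r + d - rstar M r1 + (G r - G r1)) has_real_derivative
      ftilde M H c r + 1 / h M r) (at r)"
    using rstar_deriv[of r M] G_deriv[of r] assms M L by (auto intro!: derivative_eq_intros)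
qed (use assms f1_u[OF assms(1)] in auto)

end

section \<open>Comparison of the limits at the two horizons\<close>

theorem theorem4:
  fixes M H c1 d1 r1 r4 d4 r4' d4' :: real
  assumes "M > 0"
    and "c1 > - 8 * M^3 * H"
    and "r1 > 2 * M" and "r1 + 2 * M * ln \<bar>r1 - 2 * M\<bar> = 0"
    and "r4' \<in> dom4 M H c1"
    and "c1 < CH M H \<Longrightarrow> r4 \<in> dom4 M H c1 \<and> branches_match M H c1 r4 d4 r4' d4'"
    and "connect_smoothly M (horizon_I_II' M)
           (Sigma1 M H c1 r1 d1) (Sigma4 M H c1 r4 d4 r4' d4')"
  shows "(\<forall>r>2*M. f1 M H c1 r1 d1 field_differentiable (at r) \<and>
            deriv (f1 M H c1 r1 d1) r - 1 / h M r = ftilde M H c1 r)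
    \<and> d4' = d1 - (LBINT r=ereal r4'..ereal r1. ftilde M H c1 r) + rstar M r4'
    \<and> (\<forall>r3 d3.
          c1 < CH M H \<longrightarrow>
          r4' = rturn M H c1 \<longrightarrow> r4 = rturn M H c1 \<longrightarrow> d4' = d4 \<longrightarrow> r3 = r1 \<longrightarrow>
          connect_smoothly M (horizon_II'_I' M)
            (Sigma4 M H c1 r4 d4 r4' d4') (Sigma3 M H c1 r3 d3) \<longrightarrow>
          d3 = d4' - (LBINT r=ereal (rturn M H c1)..ereal r3. ftilde M H c1 r)
                 + rstar M (rturn M H c1) \<and>
          d3 = d1 - 2 * (LBINT r=ereal (rturn M H c1)..ereal r1. ftilde M H c1 r)
                 + 2 * rstar M (rturn M H c1))"
proof -
  obtain L where "cmc_domain M H c1 L"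
    using cmc_domain_exists[OF assms(1,2)] .
  then interpret cmc_domain M H c1 L .
  have rs: "rstar M r1 = 0" using assms(4) by (simp add: rstar_def)
  have Lr1: "L < r1" using assms(3) L by simp
  obtain K where K: "\<And>b. L < b \<Longrightarrow> interval_lebesgue_integrable lborel (ereal r4') (ereal b) (ftilde M H c1)"
      "\<And>b. L < b \<Longrightarrow> (LBINT r=ereal r4'..ereal b. ftilde M H c1 r) = G b - K"
    by (rule ftilde_integral[OF assms(5)]) blast
  have "(exp (- (d1 + G (2 * M) - G r1) / (4 * M)), 0 :: real, axis 1 1 :: real ^ 3)
      = (exp (- (d4' - rstar M r4' + (G (2 * M) - K)) / (4 * M)), 0, axis 1 1)"
    by (rule connect_point_unique[OF assms(7) Sigma1_horizon[OF assms(3) rs] Sigma4_horizon_u[OF assms(5) K]])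
      (use M in \<open>auto simp: horizon_I_II'_def kruskal_def\<close>)
  then have "- (d1 + G (2 * M) - G r1) = - (d4' - rstar M r4' + (G (2 * M) - K))"
    using M by simp
  \<comment> \<open>The terms G (2 M) cancel, and G r1 - K is the integral of \<open>ftilde\<close>
    from r4' to r1.\<close>
  then have d4': "d4' = d1 - (LBINT r=ereal r4'..ereal r1. ftilde M H c1 r) + rstar M r4'"
    unfolding K(2)[OF Lr1] by linarith
  have deriv: "\<forall>r>2*M. f1 M H c1 r1 d1 field_differentiable (at r) \<and>
            deriv (f1 M H c1 r1 d1) r - 1 / h M r = ftilde M H c1 r"
    using f1_deriv[OF assms(3)]
    by (auto simp: field_differentiable_def DERIV_imp_deriv[OF f1_deriv[OF assms(3)]])
  have d3: "d3 = d4' - (LBINT r=ereal r4'..ereal r1. ftilde M H c1 r) + rstar M r4'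
      \<and> d3 = d1 - 2 * (LBINT r=ereal r4'..ereal r1. ftilde M H c1 r) + 2 * rstar M r4'"
    if "c1 < CH M H" "r4 = r4'" "d4' = d4"
      and con: "connect_smoothly M (horizon_II'_I' M)
        (Sigma4 M H c1 r4 d4 r4' d4') (Sigma3 M H c1 r1 d3)" for d3
  proof -
    \<comment> \<open>Both sides are limit points on U = 0, from \<open>f4s\<close> based at r4 =
      r4' and from \<open>f3\<close> based at r1. The same constant \<open>K\<close> serves because
      the two branches share their base point.\<close>
    have "(0 :: real, - exp ((d4' + rstar M r4' - (G (2 * M) - K)) / (4 * M)), axis 1 1 :: real ^ 3)
        = (0, - exp ((d3 - (G (2 * M) - G r1)) / (4 * M)), axis 1 1)"
      by (rule connect_point_unique[OF con[unfolded that(2) that(3)[symmetric]]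
          Sigma4_horizon_v[OF assms(5) that(1) K] Sigma3_horizon[OF assms(3) rs]])
        (use M in \<open>auto simp: horizon_II'_I'_def kruskal_def\<close>)
    then have "d4' + rstar M r4' - (G (2 * M) - K) = d3 - (G (2 * M) - G r1)"
      using M by simp
    then have "d3 = d4' - (LBINT r=ereal r4'..ereal r1. ftilde M H c1 r) + rstar M r4'"
      unfolding K(2)[OF Lr1] by linarith
    then show ?thesis using d4' by linarith
  qed
  show ?thesis
  proof (intro conjI[OF deriv] conjI[OF d4'] allI impI, goal_cases)
    case (1 r3 d3)
    then show ?case using d3[of d3] by metis
  qed
qed

end
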